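(* Let $x,y,m,n>0$ be real numbers, and let $\Omega=\{G,B\}\times\{g,b\}$ and the family $\mathcal{F}$ of subsets of $\Omega$ be as defined in the context (depending on $x,y,m,n$). The following holds: \begin{itemize} \item If $n>x$, then for any $S\subseteq\Omega$ such that $(G,g),(G,b)\in S$, it holds that $S\notin\mathcal{F}$. \item If $m>y$, then for any $S\subseteq\Omega$ such that $(B,g),(B,b)\in S$, it holds that $S\notin\mathcal{F}$. \end{itemize}
   Context: Let $\Omega=\{G,B\}\times\{g,b\}$ be the four-element state space, $\Delta\Omega$ the set of probability distributions (beliefs) on $\Omega$, and $A=\{0,1\}$ the action set ($1$ = approve, $0$ = reject). Fix real parameters $x,y,m,n>0$. The current voter's payoff $v:A\times\Omega\to\mathbb{R}$ is: $v(1,(G,g))=v(1,(G,b))=x$, $v(1,(B,g))=v(1,(B,b))=-y$, and $v(0,\omega)=0$ for all $\omega\in\Omega$. The future voter's payoff $u:A\times\Omega\to\mathbb{R}$ is: $u(1,(G,g))=x+m$, $u(1,(G,b))=x-n$, $u(1,(B,g))=m-y$, $u(1,(B,b))=-y-n$, and $u(0,\omega)=0$ for all $\omega\in\Omega$. For $\mu\in\Delta\Omega$ define $$A^*(\mu)=\arg\max_{a\in A}\sum_{\omega\in\Omega}u(a,\omega)\mu(\omega),\qquad \underline{V}(\mu)=\min_{a\in A^*(\mu)}\sum_{\omega\in\Omega}v(a,\omega)\mu(\omega),$$ $$\underline{V}_{\text{full}}(\mu)=\sum_{\omega\in\Omega}\underline{V}(\delta_\omega)\mu(\omega),$$ where $\delta_\omega$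 is the belief assigning probability one to $\omega$. For $S\subseteq\Omega$, $\Delta S$ denotes the set of $\mu\in\Delta\Omega$ whose support is contained in $S$. Define $$\mathcal{F}=\{S\subseteq\Omega:\ \underline{V}(\mu)\ge\underline{V}_{\text{full}}(\mu)\ \text{for all }\mu\in\Delta S\}.$$ *)

theory Defs
  imports "HOL-Probability.Probability_Mass_Function"
begin

datatype current_quality = G | B

datatype future_quality = g | b

type_synonym state = "current_quality \<times> future_quality"

definition Omega :: "state set" where
  "Omega = {G, B} \<times> {g, b}"

datatype action = Reject | Approve

fun payoff_current :: "real \<Rightarrow> real \<Rightarrow> action \<Rightarrow> state \<Rightarrow> real" where
  "payoff_current x y Reject \<omega> = 0"
| "payoff_current x y Approve (G, g) = x"
| "payoff_current x y Approve (G, b) = x"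
| "payoff_current x y Approve (B, g) = - y"
| "payoff_current x y Approve (B, b) = - y"

fun payoff_future :: "real \<Rightarrow> real \<Rightarrow> real \<Rightarrow> real \<Rightarrow> action \<Rightarrow> state \<Rightarrow> real" where
  "payoff_future x y m n Reject \<omega> = 0"
| "payoff_future x y m n Approve (G, g) = x + m"
| "payoff_future x y m n Approve (G, b) = x - n"
| "payoff_future x y m n Approve (B, g) = m - y"
| "payoff_future x y m n Approve (B, b) = - y - n"

definition A_star :: "real \<Rightarrow> real \<Rightarrow> real \<Rightarrow> real \<Rightarrow> state pmf \<Rightarrow> action set" where
  "A_star x y m n \<mu> =
    {a. is_arg_max (\<lambda>a. \<Sum>\<omega>\<in>Omega. payoff_future x y m n a \<omega> * pmf \<mu> \<omega>)
          (\<lambda>a. a \<in> {Reject, Approve}) a}"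

definition V_low :: "real \<Rightarrow> real \<Rightarrow> real \<Rightarrow> real \<Rightarrow> state pmf \<Rightarrow> real" where
  "V_low x y m n \<mu> =
    Min ((\<lambda>a. \<Sum>\<omega>\<in>Omega. payoff_current x y a \<omega> * pmf \<mu> \<omega>) ` A_star x y m n \<mu>)"

definition V_full :: "real \<Rightarrow> real \<Rightarrow> real \<Rightarrow> real \<Rightarrow> state pmf \<Rightarrow> real" where
  "V_full x y m n \<mu> = (\<Sum>\<omega>\<in>Omega. V_low x y m n (return_pmf \<omega>) * pmf \<mu> \<omega>)"

definition Delta :: "state set \<Rightarrow> state pmf set" where
  "Delta S = {\<mu>. set_pmf \<mu> \<subseteq> S}"

definition F_family :: "real \<Rightarrow> real \<Rightarrow> real \<Rightarrow> real \<Rightarrow> state set set" where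
  "F_family x y m n =
    {S. S \<subseteq> Omega \<and> (\<forall>\<mu>\<in>Delta S. V_low x y m n \<mu> \<ge> V_full x y m n \<mu>)}"

end

(* Take two states on which the fully informed future voter decides differently, say approving at
   p and rejecting at q, and mix them so that he is exactly indifferent. The adversarial selection
   then costs the current voter strictly more than full information, unless his own preferences
   agree with both decisions: if he likes approval at p, the tie may be broken by rejecting; if he
   dislikes approval at q, it may be broken by approving. *)
theory Submission
  imports Defs
begin

text \<open>States off the support have mass 0, so expectations over \<open>Omega\<close> shrink to
  one term for a point mass and to two terms for a two-state mixture.\<close>

lemma sum_Omega_pmf:
  assumes "set_pmf \<mu> \<subseteq> S" and "S \<subseteq> Omega"
  shows "(\<Sum>\<omega>\<in>Omega. f \<omega> * pmf \<mu> \<omega>) = (\<Sum>\<omega>\<in>S. f \<omega> * pmf \<mu> \<omega>)"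
proof -
  have "finite Omega"
    by (simp add: Omega_def)
  moreover have "pmf \<mu> \<omega> = 0" if "\<omega> \<in> Omega - S" for \<omega>
    using that assms(1) by (auto simp: pmf_eq_0_set_pmf)
  ultimately show ?thesis
    using assms(2) by (intro sum.mono_neutral_right) auto
qed

lemma A_star_eq:
  "A_star x y m n \<mu> =
    {a. \<forall>a'. (\<Sum>\<omega>\<in>Omega. payoff_future x y m n a' \<omega> * pmf \<mu> \<omega>)
           \<le> (\<Sum>\<omega>\<in>Omega. payoff_future x y m n a \<omega> * pmf \<mu> \<omega>)}"
proof -
  have "a \<in> {Reject, Approve}" for a
    by (cases a) auto
  then show ?thesis
    by (auto simp: A_star_def is_arg_max_linorder)
qed

text \<open>Rejecting always pays 0, so the sign of the expected payoff \<open>U\<close> from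
  approving settles the choice. Only a tie leaves both actions open to adversarial
  selection.\<close>

lemma A_star_cases:
  fixes x y m n :: real and \<mu> :: "state pmf"
  defines "U \<equiv> \<Sum>\<omega>\<in>Omega. payoff_future x y m n Approve \<omega> * pmf \<mu> \<omega>"
  shows "U > 0 \<Longrightarrow> A_star x y m n \<mu> = {Approve}"
    and "U < 0 \<Longrightarrow> A_star x y m n \<mu> = {Reject}"
    and "U = 0 \<Longrightarrow> A_star x y m n \<mu> = {Reject, Approve}"
proof -
  have all: "(\<forall>a. P a) \<longleftrightarrow> P Reject \<and> P Approve" for P
    by (metis action.exhaust)
  have "Reject \<in> A_star x y m n \<mu> \<longleftrightarrow> U \<le> 0" "Approve \<in> A_star x y m n \<mu> \<longleftrightarrow> 0 \<le> U"
    by (simp_all add: A_star_eq all U_def)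
  then show "U > 0 \<Longrightarrow> A_star x y m n \<mu> = {Approve}"
    and "U < 0 \<Longrightarrow> A_star x y m n \<mu> = {Reject}"
    and "U = 0 \<Longrightarrow> A_star x y m n \<mu> = {Reject, Approve}"
    by (simp_all add: set_eq_iff all)
qed

lemma V_low_return_pmf:
  assumes "\<omega> \<in> Omega"
  shows "payoff_future x y m n Approve \<omega> > 0 \<Longrightarrow>
      V_low x y m n (return_pmf \<omega>) = payoff_current x y Approve \<omega>"
    and "payoff_future x y m n Approve \<omega> < 0 \<Longrightarrow> V_low x y m n (return_pmf \<omega>) = 0"
proof -
  have "(\<Sum>\<omega>'\<in>Omega. f \<omega>' * pmf (return_pmf \<omega>) \<omega>') = f \<omega>" for f
    using sum_Omega_pmf[of "return_pmf \<omega>" "{\<omega>}" f] assms by simp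
  then show "payoff_future x y m n Approve \<omega> > 0 \<Longrightarrow>
      V_low x y m n (return_pmf \<omega>) = payoff_current x y Approve \<omega>"
    and "payoff_future x y m n Approve \<omega> < 0 \<Longrightarrow> V_low x y m n (return_pmf \<omega>) = 0"
    by (simp_all add: V_low_def A_star_cases)
qed

text \<open>The mixture is the image of a Bernoulli distribution; \<open>p \<noteq> q\<close> makes
  the relabelling injective, so the masses carry over.\<close>

lemma ex_two_point_pmf:
  fixes r :: real
  assumes "0 \<le> r" and "r \<le> 1" and "p \<noteq> q"
  obtains \<mu> where "set_pmf \<mu> \<subseteq> {p, q}" and "pmf \<mu> p = r" and "pmf \<mu> q = 1 - r"
proof
  let ?f = "\<lambda>c. if c then p else q"
  let ?\<mu> = "map_pmf ?f (bernoulli_pmf r)"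
  show "set_pmf ?\<mu> \<subseteq> {p, q}"
    by auto
  have "inj ?f"
    using assms(3) by (auto simp: inj_on_def)
  then have "pmf ?\<mu> (?f c) = pmf (bernoulli_pmf r) c" for c
    by (rule pmf_map_inj')
  from this[of True] this[of False] show "pmf ?\<mu> p = r" "pmf ?\<mu> q = 1 - r"
    using assms by simp_all
qed

lemma not_in_F_family:
  assumes S: "p \<in> S" "q \<in> S"
    and up: "payoff_future x y m n Approve p > 0"
    and uq: "payoff_future x y m n Approve q < 0"
    and v: "payoff_current x y Approve p > 0 \<or> payoff_current x y Approve q < 0"
  shows "S \<notin> F_family x y m n"
proof
  assume F: "S \<in> F_family x y m n"
  let ?u = "payoff_future x y m n Approve" and ?v = "payoff_current x y Approve"
  have pq: "p \<noteq> q" "p \<in> Omega" "q \<in> Omega"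
    using F S up uq by (auto simp: F_family_def)
  \<comment> \<open>The weight on \<open>p\<close> that solves the indifference equation
    \<open>tie\<close>; the opposite signs of \<open>?u p\<close> and \<open>?u q\<close> put it
    strictly between 0 and 1.\<close>
  define r where "r = - ?u q / (?u p - ?u q)"
  have r: "0 < r" "r < 1" and tie: "?u p * r + ?u q * (1 - r) = 0"
    using up uq by (simp_all add: r_def field_simps)
  obtain \<mu> where \<mu>: "set_pmf \<mu> \<subseteq> {p, q}" "pmf \<mu> p = r" "pmf \<mu> q = 1 - r"
    using ex_two_point_pmf[of r p q] r pq(1) by auto
  have E: "(\<Sum>\<omega>\<in>Omega. f \<omega> * pmf \<mu> \<omega>) = f p * r + f q * (1 - r)" for f
    using sum_Omega_pmf[of \<mu> "{p, q}" f] \<mu> pq by simp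
  have "A_star x y m n \<mu> = {Reject, Approve}"
    using tie by (intro A_star_cases(3)) (simp add: E)
  then have "V_low x y m n \<mu> = min 0 (?v p * r + ?v q * (1 - r))"
    by (simp add: V_low_def E)
  \<comment> \<open>Under full information \<open>q\<close> is rejected and contributes 0.\<close>
  moreover have "V_full x y m n \<mu> = ?v p * r"
    using up uq pq by (simp add: V_full_def E V_low_return_pmf)
  \<comment> \<open>In the first case \<open>V_full\<close> is positive while \<open>V_low\<close>
    is at most 0. In the second, approving at the tie yields less than
    \<open>?v p * r\<close>.\<close>
  moreover have "?v p * r > 0 \<or> ?v q * (1 - r) < 0"
    using v r by (auto simp: mult_neg_pos)
  ultimately have "V_low x y m n \<mu> < V_full x y m n \<mu>"
    by auto
  moreover have "\<mu> \<in> Delta S"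
    using \<mu>(1) S by (auto simp: Delta_def)
  ultimately show False
    using F by (fastforce simp: F_family_def)
qed

theorem theorem1:
  fixes x y m n :: real
  assumes "x > 0" and "y > 0" and "m > 0" and "n > 0"
  shows "(n > x \<longrightarrow>
            (\<forall>S. S \<subseteq> Omega \<and> (G, g) \<in> S \<and> (G, b) \<in> S \<longrightarrow> S \<notin> F_family x y m n))
       \<and> (m > y \<longrightarrow>
            (\<forall>S. S \<subseteq> Omega \<and> (B, g) \<in> S \<and> (B, b) \<in> S \<longrightarrow> S \<notin> F_family x y m n))"
proof (intro conjI impI allI)
  fix S assume "n > x" and "S \<subseteq> Omega \<and> (G, g) \<in> S \<and> (G, b) \<in> S"
  \<comment> \<open>The future voter gets \<open>x + m > 0\<close> and \<open>x - n < 0\<close> from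
    approving; the current voter gets \<open>x > 0\<close> at \<open>(G, g)\<close>, the first
    alternative of \<open>v\<close>.\<close>
  then show "S \<notin> F_family x y m n"
    using assms by (intro not_in_F_family[of "(G, g)" S "(G, b)"]) auto
next
  fix S assume "m > y" and "S \<subseteq> Omega \<and> (B, g) \<in> S \<and> (B, b) \<in> S"
  \<comment> \<open>Now the signs are \<open>m - y > 0\<close> and \<open>- y - n < 0\<close>, and
    the current voter gets \<open>- y < 0\<close> at \<open>(B, b)\<close>, the second alternative
    of \<open>v\<close>.\<close>
  then show "S \<notin> F_family x y m n"
    using assms by (intro not_in_F_family[of "(B, g)" S "(B, b)"]) auto
qed

end
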